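(* Let $c\in\mathbb{C}$ with $|c|<1$. Let $f_0(\theta)=\sum_{r=0}^\infty c^r e^{r i\theta}=\frac{1}{1-c\,e^{i\theta}}$, let $f_n=L_1(f_{n-1})$ for $n=1,2,3,\dots$, and let $M_n(\theta)=\frac1n\sum_{j=1}^n f_j(\theta)$ for $n=1,2,3,\dots$. Suppose that every Collatz sequence eventually reaches $1$, i.e. for every integer $m\ge 1$ there is an integer $k\ge 0$ with $C^k(m)=1$. Then for each $\theta\in[0,2\pi)$, $$\lim_{n\to\infty} M_n(\theta)=1+\frac13\left(e^{i\theta}+e^{2i\theta}+e^{4i\theta}\right)\frac{c}{1-c}.$$
   Context: The Collatz function $C$ is defined on positive integers by $C(n)=n/2$ for $n$ even and $C(n)=3n+1$ for $n$ odd; its iterates are $C^0(m)=m$ and $C^k(m)=C(C^{k-1}(m))$. Extend it by the convention $C(0)=0$. For complex numbers $(a_n)_{n\ge 0}$ with $\sum_{n\ge 0}|a_n|<\infty$, the operator $L_1$ is defined on the function $\theta\mapsto\sum_{n=0}^\infty a_n e^{n i\theta}$ (of a real variable $\theta$) by $$L_1\left(\sum_{n=0}^\infty a_n e^{n i \theta}\right)=\sum_{n=0}^\infty a_n e^{C(n) i\theta}.$$ In particular $L_1$ fixes constants, and its output is again an absolutely convergent series of the same form (after collecting equal exponents), so $L_1$ can be iterated. *)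

theory Defs
  imports "HOL-Analysis.Analysis"
begin

text \<open>The paper's convention for the argument 0 is met automatically: 0 is even and \<open>0 div 2 = 0\<close>.\<close>

definition collatz :: "nat \<Rightarrow> nat" where
  "collatz n = (if even n then n div 2 else 3 * n + 1)"

definition exp_series :: "(nat \<Rightarrow> complex) \<Rightarrow> real \<Rightarrow> complex" where
  "exp_series a = (\<lambda>\<theta>. \<Sum>n. a n * exp (of_nat n * \<i> * of_real \<theta>))"

text \<open>
  \<open>L\<^sub>1\<close> acts on functions of a real variable, and its value is described through the coefficients of
  the argument.  For a function that is the sum of such a series with absolutely summable
  coefficients, these are unique (\<open>exp_series_inject\<close>), so the description is proper
  (\<open>L1_exp_series\<close>); on any other function \<open>L1\<close> is unspecified.
\<close>

definition L1 :: "(real \<Rightarrow> complex) \<Rightarrow> real \<Rightarrow> complex" where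
  "L1 f = (THE g. \<exists>a. summable (\<lambda>n. norm (a n)) \<and> f = exp_series a \<and>
             g = (\<lambda>\<theta>. \<Sum>n. a n * exp (of_nat (collatz n) * \<i> * of_real \<theta>)))"

lemma has_integral_exp_int_period:
  fixes k :: int
  shows "((\<lambda>\<theta>. exp (of_int k * \<i> * of_real \<theta>)) has_integral (if k = 0 then 2 * pi else 0)) {0..2*pi}"
proof (cases "k = 0")
  case True
  then show ?thesis
    using has_integral_const_real[of "1::complex" 0 "2*pi"] by (simp add: scaleR_conv_of_real)
next
  case False
  let ?F = "\<lambda>\<theta>::real. exp (of_int k * \<i> * of_real \<theta>) / (of_int k * \<i>)"
  have "((\<lambda>\<theta>. exp (of_int k * \<i> * of_real \<theta>)) has_integral (?F (2*pi) - ?F 0)) {0..2*pi}"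
  proof (rule fundamental_theorem_of_calculus)
    fix x :: real
    have "((\<lambda>z. exp (of_int k * \<i> * z) / (of_int k * \<i>)) has_field_derivative
            exp (of_int k * \<i> * of_real x)) (at (of_real x))"
      using False by (auto intro!: derivative_eq_intros)
    then show "(?F has_vector_derivative exp (of_int k * \<i> * of_real x)) (at x within {0..2*pi})"
      by (rule has_vector_derivative_real_field)
  qed auto
  moreover have "exp (of_int k * \<i> * of_real (2*pi)) = (1::complex)"
    by (subst exp_eq_1) (auto intro!: exI[of _ k])
  ultimately show ?thesis using False by simp
qed

lemma exp_series_coeff:
  fixes a :: "nat \<Rightarrow> complex"
  assumes "summable (\<lambda>n. norm (a n))"
  shows "((\<lambda>\<theta>. exp_series a \<theta> * exp (- (of_nat m * \<i> * of_real \<theta>))) has_integral of_real (2 * pi) * a m) {0..2*pi}"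
proof -
  let ?e = "\<lambda>n \<theta>. exp (of_int (int n - int m) * \<i> * of_real \<theta>) :: complex"
  let ?S = "\<lambda>N \<theta>. \<Sum>n<N. a n * ?e n \<theta>"
  let ?g = "\<lambda>\<theta>. exp_series a \<theta> * exp (- (of_nat m * \<i> * of_real \<theta>))"
  have lim: "uniform_limit {0..2*pi} ?S (\<lambda>\<theta>. \<Sum>n. a n * ?e n \<theta>) sequentially"
    by (rule Weierstrass_m_test[OF _ assms]) (simp add: norm_mult)
  have eq: "(\<Sum>n. a n * ?e n \<theta>) = ?g \<theta>" for \<theta>
  proof -
    have "summable (\<lambda>n. a n * exp (of_nat n * \<i> * of_real \<theta>))"
      by (rule summable_norm_cancel) (use assms in \<open>simp add: norm_mult\<close>)
    from suminf_mult2[OF this, of "exp (- (of_nat m * \<i> * of_real \<theta>))"] show ?thesis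
      by (simp add: exp_series_def exp_diff exp_minus field_simps)
  qed
  have int: "(?S N has_integral (\<Sum>n<N. a n * of_real (if int n - int m = 0 then 2 * pi else 0))) {0..2*pi}" for N
    by (intro has_integral_sum has_integral_mult_right has_integral_exp_int_period) auto
  have val: "(\<Sum>n<N. a n * of_real (if int n - int m = 0 then 2 * pi else 0)) = (if m < N then of_real (2 * pi) * a m else 0)" for N
    by (simp add: if_distrib[of "\<lambda>x. _ * complex_of_real x"] sum.delta cong: if_cong)
  obtain I J where I: "\<And>N. (?S N has_integral I N) {0..2*pi}"
    and J: "((\<lambda>\<theta>. \<Sum>n. a n * ?e n \<theta>) has_integral J) {0..2*pi}" and IJ: "I \<longlonglongrightarrow> J"
    by (rule uniform_limit_integral[OF lim]) (auto intro!: continuous_intros)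
  have "I N = (if m < N then of_real (2 * pi) * a m else 0)" for N
    using has_integral_unique[OF I int] val by simp
  then have "eventually (\<lambda>N. I N = of_real (2 * pi) * a m) sequentially"
    by (intro eventually_mono[OF eventually_gt_at_top[of m]]) simp
  then have "I \<longlonglongrightarrow> of_real (2 * pi) * a m" by (rule tendsto_eventually)
  with IJ have "J = of_real (2 * pi) * a m" using LIMSEQ_unique by blast
  with J show ?thesis unfolding eq by simp
qed

lemma exp_series_inject:
  assumes "summable (\<lambda>n. norm (a n))" "summable (\<lambda>n. norm (b n))" "exp_series a = exp_series b"
  shows "a = b"
proof
  fix m
  have "of_real (2 * pi) * a m = of_real (2 * pi) * b m"
    using exp_series_coeff[OF assms(1), of m] exp_series_coeff[OF assms(2), of m]
    unfolding assms(3) by (rule has_integral_unique)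
  then show "a m = b m" by simp
qed

lemma L1_exp_series:
  assumes "summable (\<lambda>n. norm (a n))"
  shows "L1 (exp_series a) = (\<lambda>\<theta>. \<Sum>n. a n * exp (of_nat (collatz n) * \<i> * of_real \<theta>))"
  unfolding L1_def using assms by (intro the_equality) (auto dest: exp_series_inject)

lemma exp_series_geometric:
  assumes "norm c < 1"
  shows "exp_series (\<lambda>r. c ^ r) \<theta> = 1 / (1 - c * exp (\<i> * of_real \<theta>))"
proof -
  have "c ^ r * exp (of_nat r * \<i> * of_real \<theta>) = (c * exp (\<i> * of_real \<theta>)) ^ r" for r
    by (simp add: power_mult_distrib exp_of_nat_mult[symmetric] mult.assoc)
  moreover have "norm (c * exp (\<i> * of_real \<theta>)) < 1"
    using assms by (simp add: norm_mult)
  ultimately show ?thesis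
    unfolding exp_series_def by (simp add: suminf_geometric)
qed

end

theory Submission
  imports Defs
begin

text \<open>
  The \<open>j\<close>-th iterate is \<open>f\<^sub>j(\<theta>) = \<Sum>\<^sub>r c\<^sup>r e(C\<^sup>j(r))\<close> with \<open>e(m) = exp(i m \<theta>)\<close>: grouping equal exponents
  at each step amounts to pushing the summable family of coefficients forward along \<open>C\<^sup>j\<close>.  For
  \<open>r \<ge> 1\<close> the orbit of \<open>r\<close> ends in the cycle 1, 4, 2, so the Cesaro means of \<open>e(C\<^sup>j(r))\<close> converge to
  the average of \<open>e\<close> over that cycle, while \<open>r = 0\<close> contributes the constant 1.  The means are
  bounded by 1, so Tannery's theorem allows the limit to be taken term by term.
\<close>

text \<open>The fibres of \<open>g\<close> partition the index set, so \<open>n\<close> corresponds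
  to the pair \<open>(g n, n)\<close> in a \<open>Sigma\<close> type sum, and Fubini sums fibre by
  fibre. Completeness makes \<open>F\<close> summable on each fibre.\<close>

lemma has_sum_infsum_vimage:
  fixes F :: "'a \<Rightarrow> 'c::banach" and g :: "'a \<Rightarrow> 'b"
  assumes "(F has_sum S) UNIV"
  shows "((\<lambda>m. infsum F (g -` {m})) has_sum S) UNIV"
proof (rule has_sum_SigmaD)
  have "bij_betw (\<lambda>n. (g n, n)) UNIV (Sigma UNIV (\<lambda>m. g -` {m}))"
    by (rule bij_betwI[of _ _ _ snd]) auto
  from has_sum_reindex_bij_betw[OF this, of "\<lambda>(m, n). F n" S] assms
  show "((\<lambda>(m, n). F n) has_sum S) (Sigma UNIV (\<lambda>m. g -` {m}))"
    by simp
next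
  fix m
  have "F summable_on g -` {m}"
    using assms by (rule summable_on_subset_banach[OF has_sum_imp_summable]) simp
  then show "((\<lambda>n. case (m, n) of (m, n) \<Rightarrow> F n) has_sum infsum F (g -` {m})) (g -` {m})"
    by simp
qed

text \<open>The witness \<open>b m\<close> is the sum of \<open>a\<close> over the fibre of
  \<open>g\<close> at \<open>m\<close>. Leaving \<open>h\<close> free lets the same \<open>b\<close>
  be tested against several exponential families.\<close>

lemma summable_pushforward:
  fixes a :: "nat \<Rightarrow> complex" and g :: "nat \<Rightarrow> nat"
  assumes "summable (\<lambda>n. norm (a n))"
  obtains b where "summable (\<lambda>m. norm (b m))"
    "\<And>h. (\<And>m. norm (h m) \<le> 1) \<Longrightarrow> (\<Sum>m. b m * h m) = (\<Sum>n. a n * h (g n))"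
proof
  let ?b = "\<lambda>m. infsum a (g -` {m})"
  have a: "a summable_on UNIV"
    using assms by (rule norm_summable_imp_summable_on)
  have "?b summable_on UNIV"
    using has_sum_infsum_vimage[OF has_sum_infsum[OF a], of g] by (rule has_sum_imp_summable)
  then show "summable (\<lambda>m. norm (?b m))"
    \<comment> \<open>Unconditional and absolute summability coincide for complex families.\<close>
    unfolding summable_on_iff_abs_summable_on_complex by (rule summable_on_imp_summable)
  fix h :: "nat \<Rightarrow> complex"
  assume h: "\<And>m. norm (h m) \<le> 1"
  have "summable (\<lambda>n. norm (a n * h (g n)))"
    by (rule summable_comparison_test'[OF assms, of 0]) (simp add: norm_mult mult_left_le h)
  then have ah: "(\<lambda>n. a n * h (g n)) summable_on UNIV"
    by (rule norm_summable_imp_summable_on)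
  have "infsum (\<lambda>n. a n * h (g n)) (g -` {m}) = ?b m * h m" for m
  proof -
    have "infsum (\<lambda>n. a n * h (g n)) (g -` {m}) = infsum (\<lambda>n. a n * h m) (g -` {m})"
      by (rule infsum_cong) auto
    then show ?thesis by (simp add: infsum_cmult_left')
  qed
  then have "((\<lambda>m. ?b m * h m) has_sum infsum (\<lambda>n. a n * h (g n)) UNIV) UNIV"
    using has_sum_infsum_vimage[OF has_sum_infsum[OF ah], of g] by simp
  with has_sum_infsum[OF ah] show "(\<Sum>m. ?b m * h m) = (\<Sum>n. a n * h (g n))"
    by (metis has_sum_imp_sums sums_unique)
qed

lemma L1_iterate:
  assumes "summable (\<lambda>n. norm (a n))" "f 0 = exp_series a" "\<And>j. f (Suc j) = L1 (f j)"
  shows "f j \<theta> = (\<Sum>n. a n * exp (of_nat ((collatz ^^ j) n) * \<i> * of_real \<theta>))"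
proof (induction j arbitrary: \<theta>)
  case 0
  then show ?case by (simp add: assms exp_series_def)
next
  case (Suc j)
  obtain b where b: "summable (\<lambda>m. norm (b m))"
    "\<And>h. (\<And>m. norm (h m) \<le> 1) \<Longrightarrow> (\<Sum>m. b m * h m) = (\<Sum>n. a n * h ((collatz ^^ j) n))"
    using summable_pushforward[OF assms(1)] by blast
  \<comment> \<open>\<open>b\<close> is used twice: with \<open>h m\<close> the exponential of
    frequency \<open>m\<close> to recognise \<open>f j\<close>, and below with frequency
    \<open>collatz m\<close> to evaluate \<open>L1\<close>.\<close>
  have "f j = exp_series b"
    by (rule ext) (simp add: Suc.IH exp_series_def b(2))
  then have "f (Suc j) \<theta> = (\<Sum>m. b m * exp (of_nat (collatz m) * \<i> * of_real \<theta>))"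
    by (simp add: assms(3) L1_exp_series[OF b(1)])
  then show ?case by (simp add: b(2))
qed

text \<open>After subtracting the period average \<open>L\<close>, the sum over any late full period
  vanishes. The centred partial sums \<open>S\<close> are then eventually periodic, hence bounded,
  and division by \<open>n\<close> sends them to 0.\<close>

lemma cesaro_mean_eventually_periodic:
  fixes u :: "nat \<Rightarrow> 'a::real_normed_field"
  assumes "p > 0" and per: "\<And>j. j \<ge> k \<Longrightarrow> u (j + p) = u j"
  shows "(\<lambda>n. 1 / of_nat n * (\<Sum>j=1..n. u j)) \<longlonglongrightarrow> 1 / of_nat p * (\<Sum>i<p. u (k + i))"
proof -
  define L where "L = 1 / of_nat p * (\<Sum>i<p. u (k + i))"
  define S where "S n = (\<Sum>j=1..n. u j - L)" for n
  have window: "(\<Sum>i<p. u (n + i)) = of_nat p * L" if "n \<ge> k" for n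
    using that
  proof (induction n rule: dec_induct)
    case base
    then show ?case using \<open>p > 0\<close> by (simp add: L_def)
  next
    case (step n)
    \<comment> \<open>Sliding the window by one replaces \<open>u n\<close> by
      \<open>u (n + p)\<close>, which is equal.\<close>
    have "(\<Sum>i<p. u (Suc n + i)) + u n = (\<Sum>i<Suc p. u (n + i))"
      by (subst sum.lessThan_Suc_shift) (simp add: add.commute)
    also have "\<dots> = (\<Sum>i<p. u (n + i)) + u n"
      using per[OF step(1)] by simp
    finally show ?case using step.IH by simp
  qed
  have S_per: "S (n + p) = S n" if "n \<ge> k" for n
  proof -
    have "S (n + p) = S n + (\<Sum>j=n+1..n+p. u j - L)"
      unfolding S_def by (rule sum.ub_add_nat) simp
    also have "(\<Sum>j=n+1..n+p. u j - L) = (\<Sum>i<p. u (Suc n + i) - L)"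
      by (rule sum.reindex_bij_witness[of _ "\<lambda>i. Suc n + i" "\<lambda>j. j - Suc n"]) auto
    also have "\<dots> = 0"
      using window[of "Suc n"] that by (simp add: sum_subtractf)
    finally show ?thesis by simp
  qed
  \<comment> \<open>Subtracting \<open>p\<close> repeatedly brings any index below
    \<open>k + p\<close>, so \<open>S\<close> takes finitely many values.\<close>
  have "S n \<in> S ` {..<k + p}" for n
  proof (induction n rule: less_induct)
    case (less n)
    show ?case
    proof (cases "n < k + p")
      case False
      then have "S n = S (n - p)" using S_per[of "n - p"] by simp
      then show ?thesis using less[of "n - p"] False \<open>p > 0\<close> by simp
    qed simp
  qed
  then have "bounded (range S)"
    by (intro bounded_subset[OF finite_imp_bounded[of "S ` {..<k + p}"]]) auto
  then obtain B where "\<And>n. norm (S n) \<le> B" by (auto simp: bounded_iff)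
  then have "(\<lambda>n. 1 / of_nat n * S n) \<longlonglongrightarrow> 0"
    by (intro lim_null_mult_right_bounded[OF lim_1_over_n] always_eventually) auto
  then have "(\<lambda>n. 1 / of_nat n * S n + L) \<longlonglongrightarrow> L"
    using tendsto_add[OF _ tendsto_const[of L]] by fastforce
  \<comment> \<open>At \<open>n = 0\<close> division by zero gives 0, so the left side is
    \<open>L\<close> and the right side 0; hence only positive \<open>n\<close>.\<close>
  moreover have "\<forall>\<^sub>F n in sequentially. 1 / of_nat n * S n + L = 1 / of_nat n * (\<Sum>j=1..n. u j)"
    using eventually_gt_at_top[of 0]
    by eventually_elim (simp add: S_def sum_subtractf field_simps)
  ultimately show ?thesis
    unfolding L_def[symmetric] by (rule Lim_transform_eventually)
qed

lemma collatz_cesaro_mean: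
  fixes h :: "nat \<Rightarrow> 'a::real_normed_field"
  assumes "(collatz ^^ k) m = 1"
  shows "(\<lambda>n. 1 / of_nat n * (\<Sum>j=1..n. h ((collatz ^^ j) m))) \<longlonglongrightarrow> 1 / 3 * (h 1 + h 2 + h 4)"
proof -
  have cycle: "collatz (Suc 0) = 4" "collatz 4 = 2" "collatz 2 = Suc 0"
    by (simp_all add: collatz_def)
  have shift: "(collatz ^^ (k + i)) m = (collatz ^^ i) (Suc 0)" for i
    using assms by (simp add: add.commute[of k] funpow_add)
  have "(collatz ^^ (j + 3)) m = (collatz ^^ j) m" if "j \<ge> k" for j
  proof -
    \<comment> \<open>Past \<open>k\<close> the orbit of \<open>m\<close> is that of 1, and three
      steps 1, 4, 2 lead back to 1.\<close>
    have "(collatz ^^ (k + (i + 3))) m = (collatz ^^ (k + i)) m" for i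
      by (simp only: shift) (simp only: funpow_add o_apply, simp add: numeral_3_eq_3 cycle)
    from this[of "j - k"] that show ?thesis by simp
  qed
  then have "(\<lambda>n. 1 / of_nat n * (\<Sum>j=1..n. h ((collatz ^^ j) m)))
      \<longlonglongrightarrow> 1 / of_nat 3 * (\<Sum>i<3. h ((collatz ^^ (k + i)) m))"
    by (intro cesaro_mean_eventually_periodic) simp_all
  then show ?thesis
    unfolding shift by (simp add: cycle numeral_3_eq_3 ac_simps)
qed

theorem theorem5p2:
  fixes c :: complex
    and f M :: "nat \<Rightarrow> real \<Rightarrow> complex"
    and \<theta> :: real
  assumes "norm c < 1"
    and "f 0 = exp_series (\<lambda>r. c ^ r)"
    and "\<And>n. n \<ge> 1 \<Longrightarrow> f n = L1 (f (n - 1))"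
    and "\<And>n t. n \<ge> 1 \<Longrightarrow> M n t = 1 / of_nat n * (\<Sum>j=1..n. f j t)"
    and "\<And>m::nat. m \<ge> 1 \<Longrightarrow> \<exists>k. (collatz ^^ k) m = 1"
    and "\<theta> \<in> {0..<2 * pi}"
  shows "(\<lambda>n. M n \<theta>) \<longlonglongrightarrow>
           1 + 1 / 3 * (exp (\<i> * of_real \<theta>) + exp (2 * \<i> * of_real \<theta>) + exp (4 * \<i> * of_real \<theta>))
                 * (c / (1 - c))"
proof -
  define h :: "nat \<Rightarrow> complex" where "h m = exp (of_nat m * \<i> * of_real \<theta>)" for m
  define A where "A r n = 1 / of_nat n * (\<Sum>j=1..n. h ((collatz ^^ j) r))" for r n
  define L where "L = 1 / 3 * (h 1 + h 2 + h 4)"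
  have norm_h [simp]: "norm (h m) = 1" for m
    by (simp add: h_def)
  have sum_c: "summable (\<lambda>r. norm (c ^ r))"
    using assms(1) by (simp add: norm_power summable_geometric)
  have f: "f j \<theta> = (\<Sum>r. c ^ r * h ((collatz ^^ j) r))" for j
    unfolding h_def using assms(3)[of "Suc _"] by (intro L1_iterate sum_c assms(2)) simp
  have sum_f: "summable (\<lambda>r. c ^ r * h ((collatz ^^ j) r))" for j
    by (rule summable_norm_cancel) (use sum_c in \<open>simp add: norm_mult\<close>)
  have M: "M n \<theta> = (\<Sum>r. c ^ r * A r n)" if "n \<ge> 1" for n
  proof -
    have "M n \<theta> = 1 / of_nat n * (\<Sum>r. \<Sum>j=1..n. c ^ r * h ((collatz ^^ j) r))"
      using that by (simp add: assms(4) f suminf_sum[OF sum_f])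
    also have "\<dots> = (\<Sum>r. 1 / of_nat n * (\<Sum>j=1..n. c ^ r * h ((collatz ^^ j) r)))"
      by (intro suminf_mult[symmetric] summable_sum sum_f)
    also have "\<dots> = (\<Sum>r. c ^ r * A r n)"
      by (simp add: A_def sum_distrib_left mult_ac)
    finally show ?thesis .
  qed
  have A_le: "norm (A r n) \<le> 1" for r n
  proof -
    have "norm (\<Sum>j=1..n. h ((collatz ^^ j) r)) \<le> of_nat n"
      using sum_norm_le[of "{1..n}" "\<lambda>j. h ((collatz ^^ j) r)" "\<lambda>_. 1"] by simp
    then show ?thesis
      by (simp add: A_def norm_divide divide_le_eq)
  qed
  have A_lim: "A r \<longlonglongrightarrow> (if r = 0 then 1 else L)" for r
  proof (cases "r = 0")
    \<comment> \<open>The orbit of 0 is constant, so its mean is \<open>h 0 = 1\<close> for every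
      positive \<open>n\<close>.\<close>
    case True
    have "(collatz ^^ j) 0 = 0" for j
      by (induction j) (simp_all add: collatz_def)
    then have "A r n = 1" if "n > 0" for n
      using that True by (simp add: A_def h_def)
    then show ?thesis
      using True by (auto intro!: tendsto_eventually eventually_mono[OF eventually_gt_at_top[of 0]])
  next
    case False
    with assms(5)[of r] obtain k where "(collatz ^^ k) r = 1" by auto
    from collatz_cesaro_mean[OF this, of h] False show ?thesis
      by (simp add: A_def[abs_def] L_def)
  qed
  have "(\<lambda>n. \<Sum>r. c ^ r * A r n) \<longlonglongrightarrow> (\<Sum>r. c ^ r * (if r = 0 then 1 else L))"
  proof (rule tannerys_theorem[THEN conjunct2, THEN conjunct2])
    show "(\<lambda>n. c ^ r * A r n) \<longlonglongrightarrow> c ^ r * (if r = 0 then 1 else L)" for r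
      by (intro tendsto_mult tendsto_const A_lim)
    \<comment> \<open>The majorant \<open>norm (c ^ r)\<close> is independent of \<open>n\<close>
      and summable.\<close>
    show "\<forall>\<^sub>F (r, n) in at_top \<times>\<^sub>F sequentially. norm (c ^ r * A r n) \<le> norm (c ^ r)"
      by (intro always_eventually) (auto simp: norm_mult mult_left_le A_le)
  qed (use sum_c in simp_all)
  moreover have "(\<lambda>r. c ^ r * (if r = 0 then 1 else L)) sums (1 + L * (c / (1 - c)))"
  proof -
    \<comment> \<open>This is the tail \<open>r \<ge> 1\<close>, shifted to start at 0; the term
      \<open>r = 0\<close> then adds 1.\<close>
    have "(\<lambda>r. L * c * c ^ r) sums (L * c * (1 / (1 - c)))"
      by (intro sums_mult geometric_sums assms(1))
    then have "(\<lambda>r. c ^ Suc r * (if Suc r = 0 then 1 else L)) sums (L * (c / (1 - c)))"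
      by (simp add: mult_ac)
    then show ?thesis by (subst (asm) sums_Suc_iff) (simp add: add.commute)
  qed
  moreover from this have "(\<Sum>r. c ^ r * (if r = 0 then 1 else L)) = 1 + L * (c / (1 - c))"
    by (rule sums_unique[symmetric])
  ultimately have "(\<lambda>n. \<Sum>r. c ^ r * A r n) \<longlonglongrightarrow> 1 + L * (c / (1 - c))"
    by simp
  then have "(\<lambda>n. M n \<theta>) \<longlonglongrightarrow> 1 + L * (c / (1 - c))"
    \<comment> \<open>\<open>M 0\<close> is unconstrained, so the two sequences are compared from
      \<open>n = 1\<close> on.\<close>
    by (rule Lim_transform_eventually) (auto simp: M intro: eventually_mono[OF eventually_ge_at_top[of 1]])
  then show ?thesis by (simp add: L_def h_def)
qed

end
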